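(* Let $p$ be a prime and let $\Gamma(D_{2p^2})$ be the intersection graph of $D_{2p^2}$. Then the metric dimension of $\Gamma(D_{2p^2})$ is $\beta(\Gamma(D_{2p^2}))=p^2-p+1$.
   Context: $D_{2n}=\langle r,s : r^n=s^2=1,\ srs=r^{-1}\rangle$ is the dihedral group of order $2n$. The intersection graph $\Gamma(G)$ of a finite group $G$ has as vertices the proper non-trivial subgroups of $G$, two distinct vertices being adjacent iff their intersection is non-trivial. For an ordered set $W=\{w_1,\dots,w_k\}$ of vertices of a connected graph, the representation of a vertex $v$ is $(d(v,w_1),\dots,d(v,w_k))$; $W$ is a resolving set if distinct vertices have distinct representations. The metric dimension $\beta(\Gamma)$ is the minimum cardinality of a resolving set. *)

theory Defs
  imports "HOL-Algebra.Coset" "HOL-Computational_Algebra.Primes" "Graph_Theory.Graph_Theory"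
begin

section \<open>Groups given by generators and relations\<close>

datatype 'a letter = Gen 'a | Inv 'a

type_synonym 'a gword = "'a letter list"

text \<open>
  A relation \<open>u = v\<close> between words is the pair \<open>(u, v)\<close>. The generating set is the whole
  type \<open>'a\<close>, and \<open>pres_eq E\<close> is the congruence on words generated by free cancellation and
  the relations in \<open>E\<close>; its quotient is the free group on \<open>'a\<close> modulo the normal closure of
  all \<open>u v\<^sup>-\<^sup>1\<close>.
\<close>

inductive pres_eq :: "('a gword \<times> 'a gword) set \<Rightarrow> 'a gword \<Rightarrow> 'a gword \<Rightarrow> bool"
  for E :: "('a gword \<times> 'a gword) set" where
  rel: "(u, v) \<in> E \<Longrightarrow> pres_eq E u v"
| gen_inv: "pres_eq E [Gen x, Inv x] []"
| inv_gen: "pres_eq E [Inv x, Gen x] []"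
| refl: "pres_eq E u u"
| sym: "pres_eq E u v \<Longrightarrow> pres_eq E v u"
| trans: "pres_eq E u v \<Longrightarrow> pres_eq E v w \<Longrightarrow> pres_eq E u w"
| append: "pres_eq E u u' \<Longrightarrow> pres_eq E v v' \<Longrightarrow> pres_eq E (u @ v) (u' @ v')"

definition pres_class :: "('a gword \<times> 'a gword) set \<Rightarrow> 'a gword \<Rightarrow> 'a gword set" where
  "pres_class E u = {v. pres_eq E u v}"

definition presented_group :: "('a gword \<times> 'a gword) set \<Rightarrow> 'a gword set monoid" where
  "presented_group E =
    \<lparr>carrier = range (pres_class E),
     monoid.mult = (\<lambda>A B. \<Union>a\<in>A. \<Union>b\<in>B. pres_class E (a @ b)),
     monoid.one = pres_class E []\<rparr>"

section \<open>The dihedral group of order \<open>2 n\<close>\<close>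

datatype dihedral_gen = R | S

definition dihedral_group :: "nat \<Rightarrow> dihedral_gen gword set monoid" where
  "dihedral_group n = presented_group
    {(replicate n (Gen R), []),
     ([Gen S, Gen S], []),
     ([Gen S, Gen R, Gen S], [Inv R])}"

section \<open>The intersection graph of a group\<close>

text \<open>A simple graph is represented as a symmetric loop-free digraph.\<close>

definition proper_nontrivial_subgroups :: "('a, 'b) monoid_scheme \<Rightarrow> 'a set set" where
  "proper_nontrivial_subgroups G = {H. subgroup H G \<and> H \<noteq> carrier G \<and> H \<noteq> {\<one>\<^bsub>G\<^esub>}}"

definition intersection_graph :: "('a, 'b) monoid_scheme \<Rightarrow> 'a set pair_pre_digraph" where
  "intersection_graph G =
    \<lparr>pverts = proper_nontrivial_subgroups G,
     parcs = {(H, K). H \<in> proper_nontrivial_subgroups G \<and> K \<in> proper_nontrivial_subgroups G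
                      \<and> H \<noteq> K \<and> H \<inter> K \<noteq> {\<one>\<^bsub>G\<^esub>}}\<rparr>"

section \<open>Metric dimension\<close>

text \<open>The minimal number of edges of a walk from \<open>u\<close> to \<open>v\<close>; it is \<open>\<infinity>\<close> if there is none.\<close>

definition graph_dist :: "'a pair_pre_digraph \<Rightarrow> 'a \<Rightarrow> 'a \<Rightarrow> ereal" where
  "graph_dist \<Gamma> u v = wf_digraph.\<mu> (with_proj \<Gamma>) (\<lambda>_. 1) u v"

text \<open>Ordered sets are represented as lists without repetitions.\<close>

definition representation :: "'a pair_pre_digraph \<Rightarrow> 'a list \<Rightarrow> 'a \<Rightarrow> ereal list" where
  "representation \<Gamma> ws v = map (graph_dist \<Gamma> v) ws"

definition resolving_set :: "'a pair_pre_digraph \<Rightarrow> 'a list \<Rightarrow> bool" where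
  "resolving_set \<Gamma> ws \<longleftrightarrow>
    distinct ws \<and> set ws \<subseteq> pverts \<Gamma> \<and> inj_on (representation \<Gamma> ws) (pverts \<Gamma>)"

text \<open>The minimum exists for every finite graph, since listing all vertices is resolving.\<close>

definition metric_dimension :: "'a pair_pre_digraph \<Rightarrow> nat" where
  "metric_dimension \<Gamma> = (LEAST k. \<exists>ws. resolving_set \<Gamma> ws \<and> length ws = k)"

end

theory Submission
  imports Defs "HOL-Number_Theory.Cong"
begin

text \<open>
  The subgroups of \<open>D\<^bsub>2n\<^esub>\<close> are \<open>\<langle>r\<^sup>d\<rangle>\<close> and \<open>\<langle>r\<^sup>d, r\<^sup>i s\<rangle>\<close> with \<open>d\<close> dividing \<open>n\<close>.
  For \<open>n = p\<^sup>2\<close> the proper nontrivial ones are \<open>\<langle>r\<rangle>\<close>, \<open>\<langle>r\<^sup>p\<rangle>\<close>, the \<open>p\<close> groups \<open>\<langle>r\<^sup>p, r\<^sup>i s\<rangle>\<close>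
  and the \<open>p\<^sup>2\<close> reflection groups, each of which meets exactly one of the groups \<open>\<langle>r\<^sup>p, r\<^sup>i s\<rangle>\<close>.
  Twins, i.e. vertices with the same neighbours apart from each other, have equal distances to all
  further vertices, so a resolving set omits at most one element of each class of twins. The
  classes are \<open>{\<langle>r\<rangle>, \<langle>r\<^sup>p\<rangle>}\<close> and, for every \<open>i\<close>, the \<open>p\<close> reflection groups below
  \<open>\<langle>r\<^sup>p, r\<^sup>i s\<rangle>\<close>, which gives the lower bound \<open>1 + p (p - 1)\<close>. Omitting exactly one element of
  each class leaves a resolving set.
\<close>

section \<open>Normal forms of dihedral words\<close>

lemma mem_pres_class: "v \<in> pres_class E u \<longleftrightarrow> pres_eq E u v"
  by (simp add: pres_class_def)

lemma pres_class_eq_iff: "pres_class E u = pres_class E v \<longleftrightarrow> pres_eq E u v"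
proof
  assume "pres_class E u = pres_class E v"
  then show "pres_eq E u v"
    using pres_eq.refl[of E v] by (simp add: set_eq_iff mem_pres_class)
next
  assume *: "pres_eq E u v"
  then have "pres_eq E u x \<longleftrightarrow> pres_eq E v x" for x
    by (blast intro: pres_eq.trans[OF *] pres_eq.trans[OF pres_eq.sym[OF *]])
  then show "pres_class E u = pres_class E v"
    by (simp add: set_eq_iff mem_pres_class)
qed

text \<open>All classes in the union coincide, because \<open>pres_eq\<close> is compatible with
  concatenation; reflexivity supplies the representatives \<open>u\<close> and
  \<open>v\<close>.\<close>

lemma mult_pres_class:
  "pres_class E u \<otimes>\<^bsub>presented_group E\<^esub> pres_class E v = pres_class E (u @ v)"
proof -
  have "(\<Union>a\<in>pres_class E u. \<Union>b\<in>pres_class E v. pres_class E (a @ b)) = pres_class E (u @ v)"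
  proof (intro equalityI subsetI)
    fix x assume "x \<in> (\<Union>a\<in>pres_class E u. \<Union>b\<in>pres_class E v. pres_class E (a @ b))"
    then obtain a b where "pres_eq E u a" "pres_eq E v b" "pres_eq E (a @ b) x"
      by (auto simp: mem_pres_class)
    then show "x \<in> pres_class E (u @ v)"
      unfolding mem_pres_class by (blast intro: pres_eq.append pres_eq.trans[of E _ "a @ b"])
  next
    fix x assume "x \<in> pres_class E (u @ v)"
    then show "x \<in> (\<Union>a\<in>pres_class E u. \<Union>b\<in>pres_class E v. pres_class E (a @ b))"
      using pres_eq.refl[of E u] pres_eq.refl[of E v] by (force simp: mem_pres_class)
  qed
  then show ?thesis
    by (simp add: presented_group_def)
qed

abbreviation dihedral_rels :: "nat \<Rightarrow> (dihedral_gen gword \<times> dihedral_gen gword) set" where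
  "dihedral_rels n \<equiv>
    {(replicate n (Gen R), []), ([Gen S, Gen S], []), ([Gen S, Gen R, Gen S], [Inv R])}"

text \<open>A word is evaluated to \<open>r\<^sup>k\<close> or \<open>r\<^sup>k s\<close>, where \<open>k\<close> is \<open>wrot\<close> and the second form is meant
  if \<open>wsgn\<close> is \<open>-1\<close>.\<close>

fun lsgn :: "dihedral_gen letter \<Rightarrow> int" where
  "lsgn (Gen R) = 1"
| "lsgn (Inv R) = 1"
| "lsgn (Gen S) = -1"
| "lsgn (Inv S) = -1"

fun lrot :: "dihedral_gen letter \<Rightarrow> int" where
  "lrot (Gen R) = 1"
| "lrot (Inv R) = -1"
| "lrot (Gen S) = 0"
| "lrot (Inv S) = 0"

primrec wsgn :: "dihedral_gen gword \<Rightarrow> int" where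
  "wsgn [] = 1"
| "wsgn (x # u) = lsgn x * wsgn u"

primrec wrot :: "dihedral_gen gword \<Rightarrow> int" where
  "wrot [] = 0"
| "wrot (x # u) = lrot x + lsgn x * wrot u"

lemma wsgn_append: "wsgn (u @ v) = wsgn u * wsgn v"
  by (induction u) auto

text \<open>This is the multiplication rule of the semidirect product of the integers by the signs:
  a reflection on the left negates the exponent on its right.\<close>

lemma wrot_append: "wrot (u @ v) = wrot u + wsgn u * wrot v"
  by (induction u) (auto simp: algebra_simps)

lemma wsgn_cases: "wsgn u = 1 \<or> wsgn u = -1"
proof (induction u)
  case (Cons x u)
  then show ?case by (cases x rule: lsgn.cases) auto
qed simp

lemma eval_replicate_R: "wrot (replicate m (Gen R)) = int m" "wsgn (replicate m (Gen R)) = 1"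
  by (induction m) auto

text \<open>The evaluation respects free cancellation and the three relations, so it separates
  classes. This is what rules out a collapse of the presented group.\<close>

lemma pres_eq_dihedral_eval:
  assumes "pres_eq (dihedral_rels n) u v"
  shows "wsgn u = wsgn v \<and> int n dvd wrot u - wrot v"
  using assms
proof induction
  case (rel u v)
  then show ?case by (auto simp: eval_replicate_R)
next
  case (gen_inv x)
  then show ?case by (cases x) auto
next
  case (inv_gen x)
  then show ?case by (cases x) auto
next
  case (sym u v)
  then show ?case using dvd_diff_commute by metis
next
  case (trans u v w)
  then have "int n dvd (wrot u - wrot v) + (wrot v - wrot w)"
    by (intro dvd_add) simp_all
  then show ?case using trans by simp
next
  case (append u u' v v')
  have "wrot (u @ v) - wrot (u' @ v') = (wrot u - wrot u') + wsgn u * (wrot v - wrot v')"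
    using append by (simp add: wrot_append algebra_simps)
  then show ?case using append by (simp add: wsgn_append)
qed simp

definition nform :: "nat \<Rightarrow> bool \<Rightarrow> dihedral_gen gword" where
  "nform m e = replicate m (Gen R) @ (if e then [Gen S] else [])"

lemma eval_nform: "wrot (nform m e) = int m" "wsgn (nform m e) = (if e then -1 else 1)"
  by (auto simp: nform_def wrot_append wsgn_append eval_replicate_R)

section \<open>Reduction of words to normal form\<close>

context
  fixes n :: nat
  assumes n: "n > 0"
begin

abbreviation eqv (infix "\<approx>" 50) where "eqv \<equiv> pres_eq (dihedral_rels n)"

lemma eqv_rels: "replicate n (Gen R) \<approx> []" "[Gen S, Gen S] \<approx> []" "[Gen S, Gen R, Gen S] \<approx> [Inv R]"
  by (rule pres_eq.rel; simp)+

lemmas [trans] = pres_eq.trans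

lemma eqv_append_left: "v \<approx> v' \<Longrightarrow> u @ v \<approx> u @ v'"
  by (intro pres_eq.append pres_eq.refl)

lemma eqv_append_right: "u \<approx> u' \<Longrightarrow> u @ v \<approx> u' @ v"
  by (intro pres_eq.append pres_eq.refl)

lemma eqv_Cons: "v \<approx> v' \<Longrightarrow> x # v \<approx> x # v'"
  using eqv_append_left[of v v' "[x]"] by simp

lemma replicate_R_add_mult: "replicate (m + n * q) (Gen R) \<approx> replicate m (Gen R)"
proof (induction q)
  case (Suc q)
  have "replicate (m + n * Suc q) (Gen R) \<approx> replicate (m + n * q) (Gen R) @ []"
    using eqv_append_left[OF eqv_rels(1), of "replicate (m + n * q) (Gen R)"]
    by (simp add: replicate_add[symmetric] add.commute add.left_commute)
  then show ?case using pres_eq.trans[OF _ Suc] by simp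
qed (simp add: pres_eq.refl)

lemma replicate_R_cong:
  assumes "[a = b] (mod n)"
  shows "replicate a (Gen R) \<approx> replicate b (Gen R)"
proof -
  have mod: "replicate k (Gen R) \<approx> replicate (k mod n) (Gen R)" for k
    using replicate_R_add_mult[of "k mod n" "k div n"] by simp
  show ?thesis
    using pres_eq.trans[OF mod[of a] pres_eq.sym[OF mod[of b, folded assms[unfolded cong_def]]]] .
qed

lemma Inv_S_eqv: "[Inv S] \<approx> [Gen S]"
proof -
  have "[Inv S] @ [] \<approx> [Inv S] @ [Gen S, Gen S]"
    by (rule eqv_append_left[OF pres_eq.sym[OF eqv_rels(2)]])
  also have "[Inv S] @ [Gen S, Gen S] \<approx> [] @ [Gen S]"
    using eqv_append_right[OF pres_eq.inv_gen[of _ S], of "[Gen S]"] by simp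
  finally show ?thesis by simp
qed

text \<open>With \<open>n\<close> positive, the relation \<open>r^n = 1\<close> replaces an inverse
  letter by positive ones, so normal forms need no \<open>Inv\<close>.\<close>

lemma Inv_R_eqv: "[Inv R] \<approx> replicate (n - 1) (Gen R)"
proof -
  have "[Inv R] @ [] \<approx> [Inv R] @ replicate n (Gen R)"
    by (rule eqv_append_left[OF pres_eq.sym[OF eqv_rels(1)]])
  also have "\<dots> = [Inv R, Gen R] @ replicate (n - 1) (Gen R)"
    using n by (cases n) auto
  also have "\<dots> \<approx> [] @ replicate (n - 1) (Gen R)"
    by (intro eqv_append_right pres_eq.inv_gen)
  finally show ?thesis by simp
qed

lemma S_R_eqv: "[Gen S, Gen R] \<approx> replicate (n - 1) (Gen R) @ [Gen S]"
proof -
  have "[Gen S, Gen R] @ [] \<approx> [Gen S, Gen R] @ [Gen S, Gen S]"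
    by (rule eqv_append_left[OF pres_eq.sym[OF eqv_rels(2)]])
  also have "\<dots> = [Gen S, Gen R, Gen S] @ [Gen S]" by simp
  also have "\<dots> \<approx> replicate (n - 1) (Gen R) @ [Gen S]"
    by (intro eqv_append_right) (rule pres_eq.trans[OF eqv_rels(3) Inv_R_eqv])
  finally show ?thesis by simp
qed

text \<open>Each \<open>r\<close> that \<open>s\<close> passes turns into \<open>r^(n-1)\<close>,
  the positive spelling of its inverse; hence the exponent \<open>m * (n - 1)\<close>, which is
  congruent to \<open>-m\<close> modulo \<open>n\<close>.\<close>

lemma S_replicate_R_eqv:
  "Gen S # replicate m (Gen R) \<approx> replicate (m * (n - 1)) (Gen R) @ [Gen S]"
proof (induction m)
  case (Suc m)
  have "Gen S # replicate (Suc m) (Gen R) = [Gen S, Gen R] @ replicate m (Gen R)" by simp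
  also have "\<dots> \<approx> (replicate (n - 1) (Gen R) @ [Gen S]) @ replicate m (Gen R)"
    by (intro eqv_append_right S_R_eqv)
  also have "\<dots> = replicate (n - 1) (Gen R) @ (Gen S # replicate m (Gen R))" by simp
  also have "\<dots> \<approx> replicate (n - 1) (Gen R) @ (replicate (m * (n - 1)) (Gen R) @ [Gen S])"
    by (intro eqv_append_left Suc)
  also have "\<dots> = replicate (Suc m * (n - 1)) (Gen R) @ [Gen S]"
    by (simp add: replicate_add)
  finally show ?case .
qed (simp add: pres_eq.refl)

lemma nform_cong: "[a = b] (mod n) \<Longrightarrow> nform a e \<approx> nform b e"
  unfolding nform_def by (intro eqv_append_right replicate_R_cong)

lemma letter_nform_eqv: "\<exists>m' e'. x # nform m e \<approx> nform m' e'"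
proof (cases x rule: lsgn.cases)
  case 1
  then have "x # nform m e = nform (Suc m) e" by (simp add: nform_def)
  then show ?thesis by (metis pres_eq.refl)
next
  case 2
  have "[Inv R] @ nform m e \<approx> replicate (n - 1) (Gen R) @ nform m e"
    by (intro eqv_append_right Inv_R_eqv)
  also have "\<dots> = nform (n - 1 + m) e" by (simp add: nform_def replicate_add)
  finally show ?thesis using 2 by auto
next
  case *: 3
  have "Gen S # nform m e = (Gen S # replicate m (Gen R)) @ (if e then [Gen S] else [])"
    by (simp add: nform_def)
  also have "\<dots> \<approx> (replicate (m * (n - 1)) (Gen R) @ [Gen S]) @ (if e then [Gen S] else [])"
    by (intro eqv_append_right S_replicate_R_eqv)
  also have "\<dots> \<approx> nform (m * (n - 1)) (\<not> e)"
    using eqv_append_left[OF eqv_rels(2), of "replicate (m * (n - 1)) (Gen R)"]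
    by (auto simp: nform_def intro: pres_eq.refl)
  finally show ?thesis using * by auto
next
  case *: 4
  have "[Inv S] @ nform m e \<approx> [Gen S] @ nform m e"
    by (intro eqv_append_right Inv_S_eqv)
  also have "\<dots> = (Gen S # replicate m (Gen R)) @ (if e then [Gen S] else [])"
    by (simp add: nform_def)
  also have "\<dots> \<approx> (replicate (m * (n - 1)) (Gen R) @ [Gen S]) @ (if e then [Gen S] else [])"
    by (intro eqv_append_right S_replicate_R_eqv)
  also have "\<dots> \<approx> nform (m * (n - 1)) (\<not> e)"
    using eqv_append_left[OF eqv_rels(2), of "replicate (m * (n - 1)) (Gen R)"]
    by (auto simp: nform_def intro: pres_eq.refl)
  finally show ?thesis using * by auto
qed

lemma ex_nform_eqv: "\<exists>m e. u \<approx> nform m e"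
proof (induction u)
  case Nil
  have "[] \<approx> nform 0 False" by (simp add: nform_def pres_eq.refl)
  then show ?case by blast
next
  case (Cons x u)
  then obtain m e where u: "u \<approx> nform m e" by blast
  obtain m' e' where "x # nform m e \<approx> nform m' e'" using letter_nform_eqv by blast
  with eqv_Cons[OF u] show ?case by (blast intro: pres_eq.trans)
qed

text \<open>For the converse of invariance, both words are reduced to normal forms, and the
  evaluation forces these to agree in sign and to have exponents congruent modulo
  \<open>n\<close>.\<close>

lemma eqv_iff: "u \<approx> v \<longleftrightarrow> wsgn u = wsgn v \<and> int n dvd wrot u - wrot v"
proof
  assume *: "wsgn u = wsgn v \<and> int n dvd wrot u - wrot v"
  obtain a e b f where uv: "u \<approx> nform a e" "v \<approx> nform b f"
    using ex_nform_eqv by meson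
  note ev = uv[THEN pres_eq_dihedral_eval, unfolded eval_nform]
  have "e = f" using ev * by (auto split: if_splits)
  moreover have "[a = b] (mod n)"
  proof -
    have "int n dvd wrot u - int a" "int n dvd wrot v - int b"
      using ev by simp_all
    then have "int n dvd (wrot u - wrot v) + ((wrot v - int b) - (wrot u - int a))"
      using * by (intro dvd_add[OF _ dvd_diff]) simp_all
    then show ?thesis by (simp add: cong_iff_dvd_diff flip: cong_int_iff)
  qed
  ultimately have "nform a e \<approx> nform b f"
    using nform_cong by simp
  then show "u \<approx> v"
    by (rule pres_eq.trans[OF uv(1) pres_eq.trans[OF _ pres_eq.sym[OF uv(2)]]])
qed (rule pres_eq_dihedral_eval)

end

text \<open>Here \<open>rot a\<close> stands for \<open>r^a\<close> and \<open>refl a\<close> for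
  \<open>r^a s\<close>. Indexing by all integers instead of residues makes the product rules plain
  sums and differences and turns equality of elements into divisibility.\<close>

locale dihedral =
  fixes G :: "('a, 'b) monoid_scheme" (structure) and n :: int
    and rot :: "int \<Rightarrow> 'a" and refl :: "int \<Rightarrow> 'a"
  assumes n_pos: "n > 0"
    and carrier_eq: "carrier G = range rot \<union> range refl"
    and one_eq: "\<one> = rot 0"
    and rot_eq_iff: "rot a = rot b \<longleftrightarrow> n dvd a - b"
    and refl_eq_iff: "refl a = refl b \<longleftrightarrow> n dvd a - b"
    and rot_neq_refl: "rot a \<noteq> refl b"
    and rot_rot: "rot a \<otimes> rot b = rot (a + b)"
    and rot_refl: "rot a \<otimes> refl b = refl (a + b)"
    and refl_rot: "refl a \<otimes> rot b = refl (a - b)"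
    and refl_refl: "refl a \<otimes> refl b = rot (a - b)"

lemma dihedral_dihedral_group:
  assumes "n > 0"
  shows "\<exists>rot refl. dihedral (dihedral_group n) (int n) rot refl"
proof -
  let ?E = "dihedral_rels n"
  let ?w = "\<lambda>e a. nform (nat (a mod int n)) e"
  let ?el = "\<lambda>e a. pres_class ?E (?w e a)"
  have w: "wrot (?w e a) = a mod int n" "wsgn (?w e a) = (if e then -1 else 1)" for e a
    using assms by (auto simp: eval_nform)
  have class_eq: "pres_class ?E u = pres_class ?E v \<longleftrightarrow>
      wsgn u = wsgn v \<and> wrot u mod int n = wrot v mod int n" for u v
    using eqv_iff[OF assms] by (simp add: pres_class_eq_iff mod_eq_dvd_iff)
  have mult: "pres_class ?E u \<otimes>\<^bsub>dihedral_group n\<^esub> pres_class ?E v = pres_class ?E (u @ v)" for u v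
    unfolding dihedral_group_def by (rule mult_pres_class)
  have cover: "pres_class ?E u = ?el (wsgn u = -1) (wrot u)" for u
    using wsgn_cases[of u] by (auto simp: class_eq w)
  have "dihedral (dihedral_group n) (int n) (?el False) (?el True)"
  proof
    have "range (pres_class ?E) = range (?el False) \<union> range (?el True)"
    proof (intro equalityI subsetI)
      fix x assume "x \<in> range (pres_class ?E)"
      then obtain u where u: "x = pres_class ?E u" by auto
      show "x \<in> range (?el False) \<union> range (?el True)"
        unfolding u cover[of u] by (cases "wsgn u = -1") auto
    qed auto
    then show "carrier (dihedral_group n) = range (?el False) \<union> range (?el True)"
      by (simp add: dihedral_group_def presented_group_def)
    show "\<one>\<^bsub>dihedral_group n\<^esub> = ?el False 0"
      by (simp add: dihedral_group_def presented_group_def nform_def)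
  qed (use assms in \<open>auto simp: mult class_eq w wrot_append wsgn_append mod_simps mod_eq_dvd_iff\<close>)
  then show ?thesis by blast
qed

section \<open>Distances and twins in digraphs\<close>

lemma relpow_if_awalk:
  assumes "pair_wf_digraph \<Gamma>" "pre_digraph.awalk (with_proj \<Gamma>) u p v"
  shows "(u, v) \<in> parcs \<Gamma> ^^ length p"
proof -
  interpret pair_wf_digraph \<Gamma> by fact
  from assms(2) show ?thesis
    by (induction p arbitrary: u) (auto simp: awalk_Cons_iff awalk_Nil_iff simp del: relpow.simps(2) intro: relpow_Suc_I2)
qed

lemma awalk_if_relpow:
  assumes "pair_wf_digraph \<Gamma>" "u \<in> pverts \<Gamma>" "(u, v) \<in> parcs \<Gamma> ^^ k"
  shows "\<exists>p. pre_digraph.awalk (with_proj \<Gamma>) u p v \<and> length p = k"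
proof -
  interpret pair_wf_digraph \<Gamma> by fact
  from assms(2,3) show ?thesis
  proof (induction k arbitrary: u)
    case 0
    then show ?case by (auto simp: awalk_Nil_iff)
  next
    case (Suc k)
    then obtain w where w: "(u, w) \<in> parcs \<Gamma>" "(w, v) \<in> parcs \<Gamma> ^^ k"
      by (blast dest: relpow_Suc_D2)
    with Suc.IH[of w] obtain p where "awalk w p v" "length p = k"
      using in_arcsD2 by blast
    with w have "awalk u ((u, w) # p) v" "length ((u, w) # p) = Suc k"
      by (auto simp: awalk_Cons_iff)
    then show ?case by blast
  qed
qed

text \<open>With unit costs the cost of a walk is its length, so walks may be replaced by powers of
  the arc relation. The hypothesis on \<open>u\<close> matters for power 0, as the empty walk has to
  sit at a vertex.\<close>

lemma graph_dist_eq_INF: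
  assumes "pair_wf_digraph \<Gamma>" "u \<in> pverts \<Gamma>"
  shows "graph_dist \<Gamma> u v = (INF k\<in>{k. (u, v) \<in> parcs \<Gamma> ^^ k}. ereal (real k))"
proof -
  interpret pair_wf_digraph \<Gamma> by fact
  have "awalk_cost (\<lambda>_. 1) p = real (length p)" for p :: "('a \<times> 'a) list"
    by (induction p) auto
  then have "(\<lambda>p. ereal (awalk_cost (\<lambda>_. 1) p)) ` {p. awalk u p v} =
      (\<lambda>k. ereal (real k)) ` {k. (u, v) \<in> parcs \<Gamma> ^^ k}"
    using relpow_if_awalk[OF assms(1)] awalk_if_relpow[OF assms]
    by (fastforce simp: image_iff)
  then show ?thesis
    by (simp add: graph_dist_def \<mu>_def)
qed

text \<open>A nonempty set of naturals attains its infimum, while an empty one gives infinity, which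
  differs from every \<open>k\<close>.\<close>

lemma graph_dist_eq_iff:
  assumes "pair_wf_digraph \<Gamma>" "u \<in> pverts \<Gamma>"
  shows "graph_dist \<Gamma> u v = ereal (real k) \<longleftrightarrow>
    (u, v) \<in> parcs \<Gamma> ^^ k \<and> (\<forall>m<k. (u, v) \<notin> parcs \<Gamma> ^^ m)"
proof (cases "\<exists>m. (u, v) \<in> parcs \<Gamma> ^^ m")
  case True
  define l where "l = (LEAST m. (u, v) \<in> parcs \<Gamma> ^^ m)"
  have l: "(u, v) \<in> parcs \<Gamma> ^^ l" "\<And>m. (u, v) \<in> parcs \<Gamma> ^^ m \<Longrightarrow> l \<le> m"
    unfolding l_def using True by (auto intro: LeastI_ex Least_le)
  have "graph_dist \<Gamma> u v = ereal (real l)"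
    unfolding graph_dist_eq_INF[OF assms]
    using l by (intro antisym INF_lower INF_greatest) auto
  then show ?thesis
    using l by (metis ereal.inject leD le_antisym linorder_not_less of_nat_eq_iff)
next
  case False
  then have "graph_dist \<Gamma> u v = \<infinity>"
    by (simp add: graph_dist_eq_INF[OF assms] top_ereal_def)
  then show ?thesis using False by simp
qed

section \<open>Invariance of the metric dimension under graph isomorphism\<close>

lemma graph_dist_image:
  assumes wf: "pair_wf_digraph \<Gamma>" "pair_wf_digraph \<Gamma>'"
    and bij: "bij_betw f (pverts \<Gamma>) (pverts \<Gamma>')"
    and arcs: "\<And>x y. x \<in> pverts \<Gamma> \<Longrightarrow> y \<in> pverts \<Gamma> \<Longrightarrow>
        (f x, f y) \<in> parcs \<Gamma>' \<longleftrightarrow> (x, y) \<in> parcs \<Gamma>"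
    and "u \<in> pverts \<Gamma>" "v \<in> pverts \<Gamma>"
  shows "graph_dist \<Gamma>' (f u) (f v) = graph_dist \<Gamma> u v"
proof -
  have "(f u, f v) \<in> parcs \<Gamma>' ^^ k \<longleftrightarrow> (u, v) \<in> parcs \<Gamma> ^^ k" for k
    using \<open>u \<in> pverts \<Gamma>\<close>
  proof (induction k arbitrary: u)
    case 0
    with bij \<open>v \<in> pverts \<Gamma>\<close> show ?case by (auto simp: bij_betw_def inj_on_eq_iff)
  next
    case (Suc k)
    show ?case
    proof
      assume "(f u, f v) \<in> parcs \<Gamma>' ^^ Suc k"
      then obtain w' where w': "(f u, w') \<in> parcs \<Gamma>'" "(w', f v) \<in> parcs \<Gamma>' ^^ k"
        by (blast dest: relpow_Suc_D2)
      then obtain w where "w \<in> pverts \<Gamma>" "w' = f w"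
        using pair_wf_digraph.in_arcsD2[OF wf(2)] bij by (metis bij_betw_imp_surj_on imageE)
      with w' Suc show "(u, v) \<in> parcs \<Gamma> ^^ Suc k"
        by (auto simp: arcs simp del: relpow.simps(2) intro: relpow_Suc_I2)
    next
      assume "(u, v) \<in> parcs \<Gamma> ^^ Suc k"
      then obtain w where "(u, w) \<in> parcs \<Gamma>" "(w, v) \<in> parcs \<Gamma> ^^ k"
        by (blast dest: relpow_Suc_D2)
      moreover from this have "w \<in> pverts \<Gamma>"
        using pair_wf_digraph.in_arcsD2[OF wf(1)] by blast
      ultimately have "(f u, f w) \<in> parcs \<Gamma>'" "(f w, f v) \<in> parcs \<Gamma>' ^^ k"
        using Suc by (simp_all add: arcs)
      then show "(f u, f v) \<in> parcs \<Gamma>' ^^ Suc k" by (rule relpow_Suc_I2)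
    qed
  qed
  moreover have "f u \<in> pverts \<Gamma>'"
    using bij \<open>u \<in> pverts \<Gamma>\<close> by (auto simp: bij_betw_def)
  ultimately show ?thesis
    using assms by (simp add: graph_dist_eq_INF)
qed

lemma resolving_set_image:
  assumes wf: "pair_wf_digraph \<Gamma>" "pair_wf_digraph \<Gamma>'"
    and bij: "bij_betw f (pverts \<Gamma>) (pverts \<Gamma>')"
    and arcs: "\<And>x y. x \<in> pverts \<Gamma> \<Longrightarrow> y \<in> pverts \<Gamma> \<Longrightarrow>
        (f x, f y) \<in> parcs \<Gamma>' \<longleftrightarrow> (x, y) \<in> parcs \<Gamma>"
    and ws: "resolving_set \<Gamma> ws"
  shows "resolving_set \<Gamma>' (map f ws)"
proof -
  have sub: "set ws \<subseteq> pverts \<Gamma>" using ws by (simp add: resolving_set_def)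
  have rep: "representation \<Gamma>' (map f ws) (f v) = representation \<Gamma> ws v" if "v \<in> pverts \<Gamma>" for v
    using that sub graph_dist_image[OF wf bij arcs] by (auto simp: representation_def)
  have "inj_on (representation \<Gamma>' (map f ws)) (f ` pverts \<Gamma>)"
    using ws rep by (auto simp: inj_on_def resolving_set_def)
  then show ?thesis
    using ws bij sub by (auto simp: resolving_set_def bij_betw_def distinct_map intro: inj_on_subset)
qed

lemma metric_dimension_eq_if_iso:
  assumes wf: "pair_wf_digraph \<Gamma>" "pair_wf_digraph \<Gamma>'"
    and bij: "bij_betw f (pverts \<Gamma>) (pverts \<Gamma>')"
    and arcs: "\<And>x y. x \<in> pverts \<Gamma> \<Longrightarrow> y \<in> pverts \<Gamma> \<Longrightarrow>
        (f x, f y) \<in> parcs \<Gamma>' \<longleftrightarrow> (x, y) \<in> parcs \<Gamma>"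
  shows "metric_dimension \<Gamma>' = metric_dimension \<Gamma>"
proof -
  define g where "g = inv_into (pverts \<Gamma>) f"
  have g: "bij_betw g (pverts \<Gamma>') (pverts \<Gamma>)"
    unfolding g_def by (rule bij_betw_inv_into[OF bij])
  have g_in: "g x \<in> pverts \<Gamma>" and f_g: "f (g x) = x" if "x \<in> pverts \<Gamma>'" for x
    using g that bij_betw_inv_into_right[OF bij that] by (auto simp: g_def bij_betw_def)
  have g_arcs: "(g x, g y) \<in> parcs \<Gamma> \<longleftrightarrow> (x, y) \<in> parcs \<Gamma>'"
    if "x \<in> pverts \<Gamma>'" "y \<in> pverts \<Gamma>'" for x y
    using arcs[of "g x" "g y"] that by (simp add: g_in f_g)
  have "(\<exists>ws. resolving_set \<Gamma>' ws \<and> length ws = k) \<longleftrightarrow>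
      (\<exists>ws. resolving_set \<Gamma> ws \<and> length ws = k)" for k
    using resolving_set_image[OF wf bij arcs] resolving_set_image[OF wf(2,1) g g_arcs]
    by (metis length_map)
  then show ?thesis by (simp add: metric_dimension_def)
qed

text \<open>A first step inside the pair of twins is dropped, since by induction the remaining walk
  can be restarted at \<open>y\<close>; a first step to any other vertex is available from
  \<open>y\<close> as well. Dropped steps are why the new length is only bounded by
  \<open>k\<close>.\<close>

lemma twin_walk:
  assumes twins: "\<And>z. z \<notin> {u, v} \<Longrightarrow> (u, z) \<in> E \<longleftrightarrow> (v, z) \<in> E"
    and "w \<notin> {u, v}" "x \<in> {u, v}" "y \<in> {u, v}" "(x, w) \<in> E ^^ k"
  shows "\<exists>m\<le>k. (y, w) \<in> E ^^ m"
  using assms(3,5)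
proof (induction k arbitrary: x)
  case 0
  then show ?case using assms(2) by auto
next
  case (Suc k)
  then obtain z where z: "(x, z) \<in> E" "(z, w) \<in> E ^^ k"
    by (blast dest: relpow_Suc_D2)
  show ?case
  proof (cases "z \<in> {u, v}")
    case True
    then show ?thesis using Suc.IH z le_Suc_eq by blast
  next
    case False
    then have "(y, z) \<in> E" using twins[of z] z Suc.prems(1) assms(4) by auto
    with z show ?thesis by (blast intro: relpow_Suc_I2)
  qed
qed

lemma twins_graph_dist:
  assumes "pair_wf_digraph \<Gamma>" "u \<in> pverts \<Gamma>" "v \<in> pverts \<Gamma>"
    and twins: "\<And>z. z \<notin> {u, v} \<Longrightarrow> (u, z) \<in> parcs \<Gamma> \<longleftrightarrow> (v, z) \<in> parcs \<Gamma>"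
    and w: "w \<notin> {u, v}"
  shows "graph_dist \<Gamma> u w = graph_dist \<Gamma> v w"
proof -
  have "\<exists>m\<in>{m. (y, w) \<in> parcs \<Gamma> ^^ m}. ereal (real m) \<le> ereal (real k)"
    if "(x, w) \<in> parcs \<Gamma> ^^ k" "x \<in> {u, v}" "y \<in> {u, v}" for x y k
    using twin_walk[OF twins w that(2,3,1)] by auto
  then show ?thesis
    unfolding graph_dist_eq_INF[OF assms(1,2)] graph_dist_eq_INF[OF assms(1,3)]
    by (intro antisym INF_mono) auto
qed

lemma resolving_set_twins:
  assumes "pair_wf_digraph \<Gamma>" "resolving_set \<Gamma> ws" "u \<in> pverts \<Gamma>" "v \<in> pverts \<Gamma>" "u \<noteq> v"
    and "\<And>z. z \<notin> {u, v} \<Longrightarrow> (u, z) \<in> parcs \<Gamma> \<longleftrightarrow> (v, z) \<in> parcs \<Gamma>"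
  shows "u \<in> set ws \<or> v \<in> set ws"
proof (rule ccontr)
  assume "\<not> ?thesis"
  then have "representation \<Gamma> ws u = representation \<Gamma> ws v"
    unfolding representation_def
    by (intro map_cong refl twins_graph_dist[OF assms(1,3,4,6)]) auto
  then show False
    using assms(2-5) by (auto simp: resolving_set_def dest: inj_onD)
qed

section \<open>The model graph and its metric dimension\<close>

text \<open>The shape of the intersection graph of \<open>D\<^bsub>2p\<^sup>2\<^esub>\<close>: the two \<open>Centre\<close> vertices are the
  nontrivial rotation groups, the hubs are the dihedral subgroups of order \<open>2p\<close>, and the leaves
  attached to a hub are the groups generated by one of its reflections.\<close>

datatype ('i, 'j) vertex = Centre bool | Hub 'i | Leaf 'i 'j

text \<open>In the group this becomes nontrivial intersection. The final clause handles pairs of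
  centres and hubs, all of which contain \<open>r^p\<close>.\<close>

fun meets :: "('i, 'j) vertex \<Rightarrow> ('i, 'j) vertex \<Rightarrow> bool" where
  "meets (Leaf i j) (Leaf i' j') \<longleftrightarrow> i = i' \<and> j = j'"
| "meets (Leaf i j) (Hub i') \<longleftrightarrow> i = i'"
| "meets (Hub i) (Leaf i' j) \<longleftrightarrow> i = i'"
| "meets (Leaf i j) (Centre b) \<longleftrightarrow> False"
| "meets (Centre b) (Leaf i j) \<longleftrightarrow> False"
| "meets x y \<longleftrightarrow> True"

definition vertices :: "'i set \<Rightarrow> 'j set \<Rightarrow> ('i, 'j) vertex set" where
  "vertices I J = range Centre \<union> Hub ` I \<union> (\<Union>i\<in>I. Leaf i ` J)"

definition hub_graph :: "'i set \<Rightarrow> 'j set \<Rightarrow> ('i, 'j) vertex pair_pre_digraph" where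
  "hub_graph I J =
    \<lparr>pverts = vertices I J,
     parcs = {(x, y). x \<in> vertices I J \<and> y \<in> vertices I J \<and> x \<noteq> y \<and> meets x y}\<rparr>"

lemma mem_vertices [simp]:
  "Centre b \<in> vertices I J" "Hub i \<in> vertices I J \<longleftrightarrow> i \<in> I"
  "Leaf i j \<in> vertices I J \<longleftrightarrow> i \<in> I \<and> j \<in> J"
  by (auto simp: vertices_def)

lemma wf_hub_graph: "pair_wf_digraph (hub_graph I J)"
  by standard (auto simp: hub_graph_def)

lemma pverts_hub_graph [simp]: "pverts (hub_graph I J) = vertices I J"
  by (simp add: hub_graph_def)

lemma hub_graph_arc_iff:
  "(x, y) \<in> parcs (hub_graph I J) \<longleftrightarrow>
    x \<in> vertices I J \<and> y \<in> vertices I J \<and> x \<noteq> y \<and> meets x y"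
  by (simp add: hub_graph_def)

lemma resolving_set_hub_graph_length_ge:
  assumes "finite I" "finite J" "resolving_set (hub_graph I J) ws"
  shows "card I * (card J - 1) + 1 \<le> length ws"
proof -
  let ?T = "set ws"
  define L where "L i = {j \<in> J. Leaf i j \<in> ?T}" for i
  have twins: "u \<in> ?T \<or> v \<in> ?T"
    if "u \<in> vertices I J" "v \<in> vertices I J" "u \<noteq> v"
      "\<And>z. z \<notin> {u, v} \<Longrightarrow> meets u z \<longleftrightarrow> meets v z" for u v
    by (rule resolving_set_twins[OF wf_hub_graph assms(3)]) (use that in \<open>auto simp: hub_graph_arc_iff\<close>)
  have "Centre True \<in> ?T \<or> Centre False \<in> ?T"
  proof (rule twins)
    show "meets (Centre True) z \<longleftrightarrow> meets (Centre False) z" for z :: "('a, 'b) vertex"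
      by (cases z) auto
  qed auto
  then obtain b where b: "Centre b \<in> ?T" by blast
  have L: "card J - 1 \<le> card (L i)" if "i \<in> I" for i
  proof -
    \<comment> \<open>Two leaves of the same hub are twins, so at most one leaf per hub is missing
      from the resolving set.\<close>
    have "j = j'" if "j \<in> J - L i" "j' \<in> J - L i" for j j'
    proof (rule ccontr)
      assume "j \<noteq> j'"
      then have "Leaf i j \<in> ?T \<or> Leaf i j' \<in> ?T"
      proof (intro twins)
        show "meets (Leaf i j) z \<longleftrightarrow> meets (Leaf i j') z" if "z \<notin> {Leaf i j, Leaf i j'}" for z
          using that by (cases z) auto
      qed (use that \<open>i \<in> I\<close> in auto)
      with that show False by (auto simp: L_def)
    qed
    then have "card (J - L i) \<le> Suc 0"
      using assms(2) by (subst card_le_Suc0_iff_eq) auto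
    moreover have "card (J - L i) = card J - card (L i)"
      using assms(2) by (intro card_Diff_subset) (auto simp: L_def)
    ultimately show ?thesis by simp
  qed
  \<comment> \<open>The leaves at different hubs form disjoint sets without a centre, so the bounds
    for the hubs add up and \<open>Centre b\<close> contributes one more.\<close>
  have "card I * (card J - 1) \<le> (\<Sum>i\<in>I. card (L i))"
    using sum_mono[of I "\<lambda>_. card J - 1" "\<lambda>i. card (L i)"] L by simp
  also have "\<dots> = (\<Sum>i\<in>I. card (Leaf i ` L i))"
    by (intro sum.cong refl card_image[symmetric]) (auto simp: inj_on_def)
  also have "\<dots> = card (\<Union>i\<in>I. Leaf i ` L i)"
    using assms by (intro card_UN_disjoint[symmetric]) (auto simp: L_def)
  finally have "card I * (card J - 1) + 1 \<le> card (insert (Centre b) (\<Union>i\<in>I. Leaf i ` L i))"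
    using assms by (subst card_insert_disjoint) (auto simp: L_def)
  also have "\<dots> \<le> card ?T"
    using b by (intro card_mono) (auto simp: L_def)
  finally show ?thesis
    using card_length[of ws] by simp
qed

text \<open>Distances up to 2 suffice for resolving: 0 and 1 separate most pairs, and two leaves of
  different hubs are told apart by where the distance 2 occurs.\<close>

lemma graph_dist_hub_graph:
  assumes "x \<in> vertices I J"
  shows "graph_dist (hub_graph I J) x y = 0 \<longleftrightarrow> x = y"
    and "graph_dist (hub_graph I J) x y = 1 \<longleftrightarrow> x \<noteq> y \<and> (x, y) \<in> parcs (hub_graph I J)"
    and "graph_dist (hub_graph I J) x y = 2 \<longleftrightarrow>
      x \<noteq> y \<and> (x, y) \<notin> parcs (hub_graph I J) \<and>
      (\<exists>z. (x, z) \<in> parcs (hub_graph I J) \<and> (z, y) \<in> parcs (hub_graph I J))"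
  using graph_dist_eq_iff[OF wf_hub_graph, of x I J y 0] graph_dist_eq_iff[OF wf_hub_graph, of x I J y 1]
    graph_dist_eq_iff[OF wf_hub_graph, of x I J y 2] assms
  by (auto simp: numeral_2_eq_2 less_Suc_eq zero_ereal_def one_ereal_def relcomp_unfold)

lemma ex_resolving_set_hub_graph:
  assumes "finite I" "finite J" "card J \<ge> 2"
  shows "\<exists>ws. resolving_set (hub_graph I J) ws \<and> length ws = card I * (card J - 1) + 1"
proof -
  \<comment> \<open>\<open>j0\<close> is the index of the leaf left out at every hub.
    \<open>j1\<close> is the index of a leaf that is kept at every hub and serves to recognise that
    hub.\<close>
  obtain j0 j1 where j: "j0 \<in> J" "j1 \<in> J" "j1 \<noteq> j0"
    using assms(2,3) by (metis card_le_Suc0_iff_eq not_less_eq_eq numeral_2_eq_2)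
  let ?d = "graph_dist (hub_graph I J)"
  define T where "T = insert (Centre False) (\<Union>i\<in>I. Leaf i ` (J - {j0}))"
  have fin: "finite T" using assms by (auto simp: T_def)
  have "card (\<Union>i\<in>I. Leaf i ` (J - {j0})) = (\<Sum>i\<in>I. card (Leaf i ` (J - {j0})))"
    using assms by (intro card_UN_disjoint) auto
  also have "\<dots> = card I * (card J - 1)"
    using assms j by (subst card_image) (auto simp: inj_on_def)
  finally have card_T: "card T = card I * (card J - 1) + 1"
    using assms unfolding T_def by (subst card_insert_disjoint) auto
  obtain ws where ws: "set ws = T" "distinct ws"
    using finite_distinct_list[OF fin] by blast
  have "x = y" if x: "x \<in> vertices I J" and y: "y \<in> vertices I J"
    and eq: "\<And>w. w \<in> T \<Longrightarrow> ?d x w = ?d y w" for x y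
  proof -
    note dist = graph_dist_hub_graph[OF x] graph_dist_hub_graph[OF y]
    have eq0: "x = w \<longleftrightarrow> y = w" if "w \<in> T" for w
      using eq[OF that] dist(1,4) by metis
    have eq1: "x = w \<or> (meets x w \<longleftrightarrow> meets y w)" if "w \<in> T" "w \<in> vertices I J" for w
      using eq[OF that(1)] dist(2,5)[of w] eq0[OF that(1)] that(2) x y
      by (auto simp: hub_graph_arc_iff)
    have TC: "Centre False \<in> T" and TL: "\<And>i. i \<in> I \<Longrightarrow> Leaf i j1 \<in> T"
      using j by (auto simp: T_def)
    have T_iff: "Leaf i k \<in> T \<longleftrightarrow> i \<in> I \<and> k \<in> J \<and> k \<noteq> j0" for i k
      by (auto simp: T_def)
    show "x = y"
    proof (cases "x \<in> T \<or> y \<in> T")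
      case True
      then show ?thesis using eq0 by metis
    next
      case False
      then have nT: "x \<notin> T" "y \<notin> T" by simp_all
      \<comment> \<open>Two omitted leaves are separated by distance 2: a vertex strictly between
        \<open>Leaf i' j0\<close> and \<open>Leaf i j1\<close> has to be a hub carrying
        both.\<close>
      have leaf_eq: "i = i'" if "x = Leaf i j0" "y = Leaf i' j0" "i \<in> I" for i i'
      proof -
        have "(x, Hub i) \<in> parcs (hub_graph I J)" "(Hub i, Leaf i j1) \<in> parcs (hub_graph I J)"
          using that x j by (auto simp: hub_graph_arc_iff)
        then have "?d x (Leaf i j1) = 2"
          unfolding dist(3) using that j x
          by (auto simp: hub_graph_arc_iff intro!: exI[of _ "Hub i"])
        then have "?d y (Leaf i j1) = 2" using eq[OF TL[OF \<open>i \<in> I\<close>]] by simp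
        then obtain z where "meets y z" "meets z (Leaf i j1)" "z \<noteq> y" "z \<noteq> Leaf i j1"
          using dist(6)[of "Leaf i j1"] by (auto simp: hub_graph_arc_iff)
        then show ?thesis using that by (cases z) auto
      qed
      \<comment> \<open>The vertices outside \<open>T\<close> are \<open>Centre True\<close>, the
        hubs and the leaves with index \<open>j0\<close>. Meeting \<open>Centre False\<close> sets
        the leaves apart from the others; meeting \<open>Leaf i j1\<close> then singles out
        \<open>Hub i\<close>.\<close>
      have centre: "meets x (Centre False) \<longleftrightarrow> meets y (Centre False)"
        using eq1[OF TC] TC nT(1) by auto
      have leaf: "meets x (Leaf i j1) \<longleftrightarrow> meets y (Leaf i j1)" if "i \<in> I" for i
        using eq1[OF TL[OF that]] TL[OF that] nT(1) that j(2) by auto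
      show ?thesis
      proof (cases x; cases y)
        fix b b' assume "x = Centre b" "y = Centre b'"
        then show ?thesis using nT TC by (cases b; cases b') auto
      next
        fix b i assume "x = Centre b" "y = Hub i"
        then show ?thesis using leaf[of i] y by simp
      next
        fix b i assume "x = Hub i" "y = Centre b"
        then show ?thesis using leaf[of i] x by simp
      next
        fix i i' assume "x = Hub i" "y = Hub i'"
        then show ?thesis using leaf[of i] x by simp
      next
        fix i k i' k' assume xy: "x = Leaf i k" "y = Leaf i' k'"
        then have "k = j0" "k' = j0" "i \<in> I" using nT x y T_iff by auto
        then show ?thesis using leaf_eq xy by simp
      qed (use centre in simp_all)
    qed
  qed
  then have "inj_on (representation (hub_graph I J) ws) (vertices I J)"
    by (intro inj_onI) (simp add: representation_def ws(1))
  moreover have "T \<subseteq> vertices I J" by (auto simp: T_def)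
  ultimately have "resolving_set (hub_graph I J) ws"
    using ws by (simp add: resolving_set_def)
  moreover have "length ws = card T"
    using ws distinct_card[of ws] by simp
  ultimately show ?thesis using card_T by auto
qed

lemma metric_dimension_hub_graph:
  assumes "finite I" "finite J" "card J \<ge> 2"
  shows "metric_dimension (hub_graph I J) = card I * (card J - 1) + 1"
  unfolding metric_dimension_def
  using ex_resolving_set_hub_graph[OF assms] resolving_set_hub_graph_length_ge[OF assms(1,2)]
  by (intro Least_equality) auto

section \<open>Subgroups of dihedral groups\<close>

text \<open>The least positive element of \<open>A\<close> generates it, since the remainder of an
  element on division by it lies in \<open>A\<close> again and is smaller. The element
  \<open>n\<close> ensures that there is a positive one.\<close>

lemma int_subgroup_eq_multiples:
  fixes A :: "int set"
  assumes diff: "\<And>a b. a \<in> A \<Longrightarrow> b \<in> A \<Longrightarrow> a - b \<in> A" and "n \<in> A" "n > 0"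
  obtains d where "d > 0" "A = {k. d dvd k}"
proof -
  define m where "m = (LEAST m. m > 0 \<and> int m \<in> A)"
  have "nat n > 0 \<and> int (nat n) \<in> A" using assms by simp
  then have m: "m > 0" "int m \<in> A" and least: "\<And>k. k > 0 \<Longrightarrow> int k \<in> A \<Longrightarrow> m \<le> k"
    using LeastI[of "\<lambda>m. m > 0 \<and> int m \<in> A" "nat n"] Least_le[of "\<lambda>m. m > 0 \<and> int m \<in> A"]
    unfolding m_def by auto
  have "0 \<in> A" using diff[OF \<open>n \<in> A\<close> \<open>n \<in> A\<close>] by simp
  then have neg: "a \<in> A \<Longrightarrow> - a \<in> A" for a using diff[of 0 a] by simp
  then have add: "a \<in> A \<Longrightarrow> b \<in> A \<Longrightarrow> a + b \<in> A" for a b using diff[of a "- b"] by simp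
  have mult: "int m * q \<in> A" for q
  proof (induction q rule: int_induct[where k = 0])
    case base
    then show ?case using \<open>0 \<in> A\<close> by simp
  next
    case (step1 i)
    then show ?case using add[OF _ m(2)] by (simp add: distrib_left)
  next
    case (step2 i)
    then show ?case using diff[OF _ m(2)] by (simp add: right_diff_distrib)
  qed
  have "int m dvd a" if "a \<in> A" for a
  proof (rule ccontr)
    assume "\<not> int m dvd a"
    then have "a mod int m > 0" using m(1) by (simp add: dvd_eq_mod_eq_0 order_neq_le_trans)
    moreover have "a mod int m \<in> A"
      using diff[OF that mult[of "a div int m"]] by (simp add: minus_mult_div_eq_mod)
    ultimately have "int m \<le> a mod int m" using least[of "nat (a mod int m)"] by simp
    moreover have "a mod int m < int m" using m(1) by simp
    ultimately show False by linarith
  qed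
  then have "A = {k. int m dvd k}" using mult by (auto elim: dvdE)
  then show ?thesis using m(1) that[of "int m"] by simp
qed

context dihedral
begin

lemma is_group: "group G"
proof (rule groupI)
  fix x assume "x \<in> carrier G"
  then consider a where "x = rot a" | a where "x = refl a" by (auto simp: carrier_eq)
  then show "\<exists>y\<in>carrier G. y \<otimes> x = \<one>"
  proof cases
    case 1
    then have "rot (- a) \<otimes> x = \<one>" by (simp add: rot_rot one_eq)
    then show ?thesis by (auto simp: carrier_eq)
  next
    case 2
    then have "x \<otimes> x = \<one>" by (simp add: refl_refl one_eq)
    then show ?thesis using \<open>x \<in> carrier G\<close> by blast
  qed
qed (auto simp: carrier_eq one_eq rot_rot rot_refl refl_rot refl_refl algebra_simps)

lemma inv_rot: "inv rot a = rot (- a)"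
  by (rule group.inv_equality[OF is_group]) (auto simp: rot_rot one_eq carrier_eq)

lemma inv_refl: "inv refl a = refl a"
  by (rule group.inv_equality[OF is_group]) (auto simp: refl_refl one_eq carrier_eq)

definition rotations :: "int \<Rightarrow> 'a set" where
  "rotations d = rot ` {k. d dvd k}"

text \<open>For \<open>d\<close> dividing \<open>n\<close> this is the subgroup generated by
  \<open>r^d\<close> and \<open>r^i s\<close>. The extremes are the whole group for
  \<open>d = 1\<close> and the group of order 2 with the single reflection \<open>r^i s\<close> for
  \<open>d = n\<close>.\<close>

definition dihedrals :: "int \<Rightarrow> int \<Rightarrow> 'a set" where
  "dihedrals d i = rotations d \<union> refl ` {k. d dvd k - i}"

context
  fixes d :: int
  assumes d: "d dvd n"
begin

text \<open>The exponent of a rotation is determined only modulo \<open>n\<close>, but its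
  divisibility by \<open>d\<close> is well defined because \<open>d\<close> divides
  \<open>n\<close>.\<close>

lemma rot_mem_rotations: "rot k \<in> rotations d \<longleftrightarrow> d dvd k"
proof -
  have "d dvd k" if "n dvd k - m" "d dvd m" for m
    using dvd_add[OF dvd_trans[OF d that(1)] that(2)] by simp
  then show ?thesis by (auto simp: rotations_def rot_eq_iff)
qed

lemma refl_mem_rotations: "refl k \<notin> rotations d"
  by (auto simp: rotations_def rot_neq_refl[symmetric])

lemma rot_mem_dihedrals: "rot k \<in> dihedrals d i \<longleftrightarrow> d dvd k"
  using rot_mem_rotations rot_neq_refl by (auto simp: dihedrals_def)

lemma refl_mem_dihedrals: "refl k \<in> dihedrals d i \<longleftrightarrow> d dvd k - i"
proof -
  have "d dvd k - i" if "n dvd k - m" "d dvd m - i" for m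
    using dvd_add[OF dvd_trans[OF d that(1)] that(2)] by simp
  then show ?thesis using refl_mem_rotations by (auto simp: dihedrals_def refl_eq_iff)
qed

lemmas mem_simps = rot_mem_rotations refl_mem_rotations rot_mem_dihedrals refl_mem_dihedrals

lemma rotations_subset_carrier: "rotations d \<subseteq> carrier G"
  and dihedrals_subset_carrier: "dihedrals d i \<subseteq> carrier G"
  by (auto simp: rotations_def dihedrals_def carrier_eq)

lemma subgroup_rotations: "subgroup (rotations d) G"
proof (rule group.subgroupI[OF is_group rotations_subset_carrier])
  show "rotations d \<noteq> {}" using rot_mem_rotations[of 0] by blast
  fix x assume "x \<in> rotations d"
  then obtain a where a: "x = rot a" "d dvd a" by (auto simp: rotations_def)
  then show "inv x \<in> rotations d" by (simp add: inv_rot rot_mem_rotations)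
  fix y assume "y \<in> rotations d"
  then obtain b where "y = rot b" "d dvd b" by (auto simp: rotations_def)
  with a show "x \<otimes> y \<in> rotations d" by (simp add: rot_rot rot_mem_rotations)
qed

lemma subgroup_dihedrals: "subgroup (dihedrals d i) G"
proof (rule group.subgroupI[OF is_group dihedrals_subset_carrier])
  show "dihedrals d i \<noteq> {}" using rot_mem_dihedrals[of 0] by blast
  fix x assume "x \<in> dihedrals d i"
  then consider a where "x = rot a" "d dvd a" | a where "x = refl a" "d dvd a - i"
    by (auto simp: dihedrals_def rotations_def)
  note x = this
  from x show "inv x \<in> dihedrals d i"
    by cases (simp_all add: inv_rot inv_refl mem_simps)
  fix y assume "y \<in> dihedrals d i"
  then consider b where "y = rot b" "d dvd b" | b where "y = refl b" "d dvd b - i"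
    by (auto simp: dihedrals_def rotations_def)
  note y = this
  from x show "x \<otimes> y \<in> dihedrals d i"
  proof cases
    case x: (1 a)
    from y show ?thesis
    proof cases
      case (2 b)
      have "d dvd a + (b - i)" using x(2) 2(2) by (rule dvd_add)
      then show ?thesis using x 2 by (simp add: rot_refl mem_simps algebra_simps)
    qed (use x in \<open>simp add: rot_rot mem_simps\<close>)
  next
    case x: (2 a)
    from y show ?thesis
    proof cases
      case (1 b)
      have "d dvd (a - i) - b" using x(2) 1(2) by (rule dvd_diff)
      also have "(a - i) - b = (a - b) - i" by simp
      finally show ?thesis by (simp add: x 1 refl_rot refl_mem_dihedrals)
    next
      case (2 b)
      have "d dvd (a - i) - (b - i)" using x(2) 2(2) by (rule dvd_diff)
      then show ?thesis using x 2 by (simp add: refl_refl mem_simps)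
    qed
  qed
qed

end

text \<open>The exponents of the rotations in \<open>L\<close> form a subgroup of the integers
  containing \<open>n\<close>, hence consist of the multiples of some \<open>d\<close>.
  Multiplication by one reflection \<open>refl i\<close> of \<open>L\<close>, if there is any,
  exchanges the rotations and reflections of \<open>L\<close> and so determines the latter.\<close>

lemma subgroup_cases:
  assumes L: "subgroup L G"
  obtains (rotations) d where "d > 0" "d dvd n" "L = rotations d"
    | (dihedrals) d i where "d > 0" "d dvd n" "L = dihedrals d i"
proof -
  interpret subgroup L G by fact
  have rot_diff: "rot (a - b) \<in> L" if "rot a \<in> L" "rot b \<in> L" for a b
    using m_closed[OF that(1) m_inv_closed[OF that(2)]] by (simp add: inv_rot rot_rot)
  have "rot n = rot 0" by (simp add: rot_eq_iff)
  then have "rot n \<in> L" using one_closed by (simp add: one_eq)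
  then obtain d where d: "d > 0" "{k. rot k \<in> L} = {k. d dvd k}"
    using int_subgroup_eq_multiples[of "{k. rot k \<in> L}" n] rot_diff n_pos by auto
  then have rot_iff: "rot k \<in> L \<longleftrightarrow> d dvd k" for k by auto
  have dn: "d dvd n" using \<open>rot n \<in> L\<close> rot_iff by simp
  show thesis
  proof (cases "\<exists>i. refl i \<in> L")
    case True
    then obtain i where i: "refl i \<in> L" ..
    have refl_iff: "refl k \<in> L \<longleftrightarrow> d dvd k - i" for k
    proof
      assume "refl k \<in> L"
      then show "d dvd k - i" using m_closed[of "refl k" "refl i"] i rot_iff by (simp add: refl_refl)
    next
      assume "d dvd k - i"
      then show "refl k \<in> L" using m_closed[of "rot (k - i)" "refl i"] i rot_iff by (simp add: rot_refl)
    qed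
    have "L = dihedrals d i"
      using subset by (auto simp: carrier_eq dihedrals_def rotations_def rot_iff refl_iff)
    then show ?thesis using d dn dihedrals by blast
  next
    case False
    then have "L = rotations d"
      using subset by (auto simp: carrier_eq rotations_def rot_iff)
    then show ?thesis using d dn rotations by blast
  qed
qed

text \<open>A reflection is never the identity, and \<open>rot k\<close> is the identity exactly if
  \<open>n\<close> divides \<open>k\<close>. This reduces adjacency in the intersection graph to
  divisibility of exponents.\<close>

lemma subgroup_Int_nontrivial_iff:
  assumes "subgroup H G" "subgroup K G"
  shows "H \<inter> K \<noteq> {\<one>} \<longleftrightarrow>
    (\<exists>k. \<not> n dvd k \<and> rot k \<in> H \<and> rot k \<in> K) \<or> (\<exists>k. refl k \<in> H \<and> refl k \<in> K)"
proof -
  have one: "\<one> \<in> H \<inter> K" and sub: "H \<inter> K \<subseteq> carrier G"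
    using assms by (auto dest: subgroup.one_closed subgroup.subset)
  have rot_one: "rot k = \<one> \<longleftrightarrow> n dvd k" for k by (simp add: one_eq rot_eq_iff)
  have refl_one: "refl k \<noteq> \<one>" for k using rot_neq_refl[of 0 k] by (simp add: one_eq)
  have "H \<inter> K \<noteq> {\<one>} \<longleftrightarrow> (\<exists>x\<in>carrier G. x \<in> H \<inter> K \<and> x \<noteq> \<one>)"
    using one sub by blast
  then show ?thesis
    unfolding carrier_eq using rot_one refl_one by auto
qed

lemma rotations_eq_iff:
  assumes "d dvd n" "e dvd n" "d > 0" "e > 0"
  shows "rotations d = rotations e \<longleftrightarrow> d = e"
proof
  assume "rotations d = rotations e"
  then have "d dvd k \<longleftrightarrow> e dvd k" for k
    using rot_mem_rotations assms by metis
  then show "d = e" using assms by (metis dvd_refl zdvd_antisym_nonneg less_imp_le)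
qed simp

lemma dihedrals_eq_iff:
  assumes "d dvd n" "e dvd n" "d > 0" "e > 0"
  shows "dihedrals d i = dihedrals e j \<longleftrightarrow> d = e \<and> d dvd i - j"
proof
  assume eq: "dihedrals d i = dihedrals e j"
  then have "d dvd k \<longleftrightarrow> e dvd k" for k
    using rot_mem_dihedrals assms by metis
  then have "d = e" using assms by (metis dvd_refl zdvd_antisym_nonneg less_imp_le)
  moreover have "e dvd i - j"
    using eq refl_mem_dihedrals[OF assms(1), of i i] refl_mem_dihedrals[OF assms(2), of i j] by simp
  ultimately show "d = e \<and> d dvd i - j" by simp
next
  assume *: "d = e \<and> d dvd i - j"
  then have "d dvd k - i \<longleftrightarrow> d dvd k - j" for k
    using dvd_add[of d "k - i" "i - j"] dvd_diff[of d "k - j" "i - j"] by auto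
  then show "dihedrals d i = dihedrals e j" using * by (simp add: dihedrals_def)
qed

lemma rotations_neq_dihedrals: "d dvd n \<Longrightarrow> e dvd n \<Longrightarrow> rotations d \<noteq> dihedrals e i"
  using refl_mem_rotations[of d i] refl_mem_dihedrals[of e i i] by auto

lemma carrier_eq_dihedrals: "carrier G = dihedrals 1 i"
  by (auto simp: carrier_eq dihedrals_def rotations_def)

lemma one_eq_rotations: "{\<one>} = rotations n"
  by (auto simp: one_eq rotations_def rot_eq_iff)

end

section \<open>The dihedral group for \<open>n = p^2\<close> and its isomorphism with the model
  graph\<close>

locale dihedral_prime_square = dihedral G "p\<^sup>2" rot refl
  for G :: "('a, 'b) monoid_scheme" (structure) and p :: int and rot refl +
  assumes prime_p: "prime p"
begin

lemma p_bounds: "1 < p" "p < p\<^sup>2" "0 < p"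
  using prime_gt_1_int[OF prime_p] by (auto simp: power2_eq_square)

lemma p_neq: "p \<noteq> 1" "1 \<noteq> p" "p \<noteq> p\<^sup>2" "p\<^sup>2 \<noteq> p" "p\<^sup>2 \<noteq> 1" "1 \<noteq> p\<^sup>2" "p \<noteq> 0"
  using p_bounds by linarith+

lemma p_dvd: "1 dvd p\<^sup>2" "p dvd p\<^sup>2" "p\<^sup>2 dvd p\<^sup>2"
  by (auto simp: power2_eq_square)

lemma dvd_p_square:
  assumes "d dvd p\<^sup>2" "d > 0"
  shows "d = 1 \<or> d = p \<or> d = p\<^sup>2"
proof -
  obtain m where m: "m \<le> 2" "normalize d = p ^ m"
    using divides_primepow[OF prime_p assms(1)] .
  from m(1) have "m = 0 \<or> m = 1 \<or> m = 2" by auto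
  then show ?thesis using m(2) assms(2) by auto
qed

text \<open>The exponent \<open>i + p * j\<close> of the reflection at a leaf is written in base
  \<open>p\<close>: the low digit \<open>i\<close> selects the hub containing the reflection, and
  \<open>j\<close> numbers the reflections within that hub.\<close>

fun subgroup_of :: "(int, int) vertex \<Rightarrow> 'a set" where
  "subgroup_of (Centre b) = rotations (if b then p else 1)"
| "subgroup_of (Hub i) = dihedrals p i"
| "subgroup_of (Leaf i j) = dihedrals (p\<^sup>2) (i + p * j)"

abbreviation "V \<equiv> vertices {0..<p} {0..<p}"

lemma index_dvd_iff:
  assumes "i \<in> {0..<p}" "j \<in> {0..<p}"
  shows "p dvd i - j \<longleftrightarrow> i = j"
proof -
  have "p dvd i - j \<longleftrightarrow> i mod p = j mod p" by (rule mod_eq_dvd_iff[symmetric])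
  then show ?thesis using assms by simp
qed

text \<open>This is uniqueness of base-\<open>p\<close> digits: reduction modulo \<open>p\<close>
  gives \<open>i = i'\<close>, after which one factor \<open>p\<close> cancels.\<close>

lemma leaf_index_eq_iff:
  assumes "{i, j, i', j'} \<subseteq> {0..<p}"
  shows "p\<^sup>2 dvd (i + p * j) - (i' + p * j') \<longleftrightarrow> i = i' \<and> j = j'"
proof
  assume *: "p\<^sup>2 dvd (i + p * j) - (i' + p * j')"
  have "p dvd (i + p * j) - (i' + p * j')" using dvd_trans[OF p_dvd(2) *] .
  moreover have "(i + p * j) - (i' + p * j') = (i - i') + p * (j - j')" by (simp add: algebra_simps)
  ultimately have "p dvd i - i'" by (simp add: dvd_add_left_iff)
  then have i: "i = i'" using assms index_dvd_iff by simp
  with * have "p * p dvd p * (j - j')" by (simp add: power2_eq_square right_diff_distrib)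
  then have "p dvd j - j'" using p_bounds by simp
  then have "j = j'" using assms index_dvd_iff by simp
  with i show "i = i' \<and> j = j'" by simp
qed simp

lemma subgroup_subgroup_of: "subgroup (subgroup_of x) G"
  using p_dvd by (cases x) (auto intro!: subgroup_rotations subgroup_dihedrals)

lemmas subgroup_eq_simps =
  rotations_eq_iff dihedrals_eq_iff rotations_neq_dihedrals rotations_neq_dihedrals[symmetric]
  p_dvd p_neq p_bounds

lemma inj_on_subgroup_of: "inj_on subgroup_of V"
proof (rule inj_onI)
  have no_centre: "rotations (if b then p else 1) \<noteq> dihedrals d i" if "d dvd p\<^sup>2" for b d i
    using that p_dvd rotations_neq_dihedrals by simp
  fix x y assume *: "x \<in> V" "y \<in> V" "subgroup_of x = subgroup_of y"
  show "x = y"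
  proof (cases x; cases y)
    fix i i' assume "x = Hub i" "y = Hub i'"
    then show ?thesis using * by (simp add: subgroup_eq_simps index_dvd_iff)
  next
    fix i j i' j' assume xy: "x = Leaf i j" "y = Leaf i' j'"
    with * have "p\<^sup>2 dvd (i + p * j) - (i' + p * j')" by (simp add: subgroup_eq_simps)
    moreover have "{i, j, i', j'} \<subseteq> {0..<p}" using * xy by simp
    ultimately show ?thesis using xy leaf_index_eq_iff by metis
  next
    fix b b' assume "x = Centre b" "y = Centre b'"
    then show ?thesis using * by (simp add: subgroup_eq_simps split: if_splits)
  next
    fix b i assume "x = Centre b" "y = Hub i"
    then show ?thesis using * no_centre p_dvd by simp
  next
    fix b i assume "y = Centre b" "x = Hub i"
    then show ?thesis using * no_centre[symmetric] p_dvd by simp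
  next
    fix b i j assume "x = Centre b" "y = Leaf i j"
    then show ?thesis using * no_centre p_dvd by simp
  next
    fix b i j assume "y = Centre b" "x = Leaf i j"
    then show ?thesis using * no_centre[symmetric] p_dvd by simp
  next
    fix k i j assume "x = Hub k" "y = Leaf i j"
    then show ?thesis using * by (simp add: dihedrals_eq_iff p_dvd p_bounds p_neq)
  next
    fix k i j assume "y = Hub k" "x = Leaf i j"
    then show ?thesis using * by (simp add: dihedrals_eq_iff p_dvd p_bounds p_neq)
  qed
qed

lemma subgroup_of_neq_carrier: "subgroup_of x \<noteq> carrier G"
  unfolding carrier_eq_dihedrals[of 0] by (cases x) (simp_all add: subgroup_eq_simps)

lemma subgroup_of_neq_one: "subgroup_of x \<noteq> {\<one>}"
  unfolding one_eq_rotations by (cases x) (simp_all add: subgroup_eq_simps)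

text \<open>In the classification of subgroups \<open>d\<close> can only be 1, \<open>p\<close> or
  \<open>p^2\<close>. Properness excludes \<open>dihedrals 1 i\<close> and nontriviality excludes
  \<open>rotations (p^2)\<close>; the other families are the vertices.\<close>

lemma ex_vertex:
  assumes "L \<in> proper_nontrivial_subgroups G"
  shows "\<exists>x\<in>V. L = subgroup_of x"
proof -
  from assms have L: "subgroup L G" "L \<noteq> carrier G" "L \<noteq> {\<one>}"
    by (auto simp: proper_nontrivial_subgroups_def)
  from L(1) show ?thesis
  proof (cases rule: subgroup_cases)
    case (rotations d)
    with dvd_p_square[of d] L(3) one_eq_rotations have "d = 1 \<or> d = p" by auto
    then show ?thesis
    proof
      assume "d = 1"
      then show ?thesis using rotations by (intro bexI[of _ "Centre False"]) auto
    next
      assume "d = p"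
      then show ?thesis using rotations by (intro bexI[of _ "Centre True"]) auto
    qed
  next
    case (dihedrals d i)
    with dvd_p_square[of d] L(2) carrier_eq_dihedrals have "d = p \<or> d = p\<^sup>2" by auto
    then show ?thesis
    proof
      assume "d = p"
      then have "L = subgroup_of (Hub (i mod p))"
        using dihedrals p_bounds p_dvd by (simp add: dihedrals_eq_iff dvd_minus_mod)
      then show ?thesis using p_bounds by (intro bexI[of _ "Hub (i mod p)"]) simp_all
    next
      assume d: "d = p\<^sup>2"
      let ?k = "i mod p\<^sup>2"
      have k: "0 \<le> ?k" "?k < p * p" using p_bounds by (auto simp flip: power2_eq_square)
      \<comment> \<open>The two base-\<open>p\<close> digits of the residue \<open>?k\<close> are
        the indices of the leaf; the upper one is below \<open>p\<close> because \<open>?k\<close>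
        is below \<open>p * p\<close>.\<close>
      have "?k mod p + p * (?k div p) = ?k" by simp
      then have "L = subgroup_of (Leaf (?k mod p) (?k div p))"
        using dihedrals p_bounds p_dvd d by (simp add: dihedrals_eq_iff dvd_minus_mod)
      moreover have "?k div p < p"
      proof (rule ccontr)
        assume "\<not> ?thesis"
        then have "p * p \<le> ?k div p * p" using p_bounds by (intro mult_right_mono) auto
        also have "\<dots> = ?k - ?k mod p" by (simp only: minus_mod_eq_div_mult)
        also have "\<dots> \<le> ?k" using p_bounds by simp
        finally show False using k by linarith
      qed
      ultimately show ?thesis
        using p_bounds k by (intro bexI[of _ "Leaf (?k mod p) (?k div p)"]) (simp_all add: pos_imp_zdiv_nonneg_iff)
    qed
  qed
qed

lemma bij_subgroup_of: "bij_betw subgroup_of V (proper_nontrivial_subgroups G)"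
proof -
  have "subgroup_of ` V = proper_nontrivial_subgroups G"
    using ex_vertex subgroup_subgroup_of subgroup_of_neq_carrier subgroup_of_neq_one
    by (auto simp: proper_nontrivial_subgroups_def)
  then show ?thesis using inj_on_subgroup_of by (simp add: bij_betw_def)
qed

lemma Int_nontrivial_iff_meets:
  assumes "x \<in> V" "y \<in> V"
  shows "subgroup_of x \<inter> subgroup_of y \<noteq> {\<one>} \<longleftrightarrow> meets x y"
proof -
  note iff = subgroup_Int_nontrivial_iff[OF subgroup_subgroup_of subgroup_subgroup_of]
  note mem = mem_simps[OF p_dvd(1)] mem_simps[OF p_dvd(2)] mem_simps[OF p_dvd(3)]
  \<comment> \<open>The rotation \<open>r^p\<close> is nontrivial and lies in every centre and every
    hub, so these meet pairwise.\<close>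
  have np: "\<not> p\<^sup>2 dvd p" using p_bounds zdvd_not_zless by auto
  have rot_p: "\<exists>k. \<not> p\<^sup>2 dvd k \<and> p dvd k" "\<exists>k. \<not> p\<^sup>2 dvd k" using np by auto
  have leaf_hub: "(\<exists>k. p\<^sup>2 dvd k - (i + p * j) \<and> p dvd k - i') \<longleftrightarrow> i = i'"
    if "i \<in> {0..<p}" "i' \<in> {0..<p}" for i j i'
  proof
    assume "\<exists>k. p\<^sup>2 dvd k - (i + p * j) \<and> p dvd k - i'"
    then obtain k where "p\<^sup>2 dvd k - (i + p * j)" and k: "p dvd k - i'" by blast
    then have "p dvd k - (i + p * j)" using p_dvd(2) dvd_trans by blast
    from dvd_diff[OF k this] have "p dvd (i - i') + p * j" by (simp add: algebra_simps)
    then have "p dvd i - i'" by (simp add: dvd_add_left_iff)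
    then show "i = i'" using that index_dvd_iff by simp
  next
    assume "i = i'"
    then show "\<exists>k. p\<^sup>2 dvd k - (i + p * j) \<and> p dvd k - i'"
      by (intro exI[of _ "i + p * j"]) simp
  qed
  have leaf_leaf: "(\<exists>k. p\<^sup>2 dvd k - (i + p * j) \<and> p\<^sup>2 dvd k - (i' + p * j')) \<longleftrightarrow> i = i' \<and> j = j'"
    if "{i, j, i', j'} \<subseteq> {0..<p}" for i j i' j'
  proof
    assume "\<exists>k. p\<^sup>2 dvd k - (i + p * j) \<and> p\<^sup>2 dvd k - (i' + p * j')"
    then obtain k where k: "p\<^sup>2 dvd k - (i + p * j)" "p\<^sup>2 dvd k - (i' + p * j')" by blast
    from dvd_diff[OF k(2,1)] show "i = i' \<and> j = j'"
      using leaf_index_eq_iff[OF that] by (simp add: algebra_simps)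
  next
    assume "i = i' \<and> j = j'"
    then show "\<exists>k. p\<^sup>2 dvd k - (i + p * j) \<and> p\<^sup>2 dvd k - (i' + p * j')"
      by (intro exI[of _ "i + p * j"]) simp
  qed
  \<comment> \<open>This is \<open>leaf_hub\<close> in the order in which the conditions arise when
    the hub comes first.\<close>
  have leaf_hub': "(\<exists>k. p dvd k - i' \<and> p\<^sup>2 dvd k - (i + p * j)) \<longleftrightarrow> i' = i"
    if "i \<in> {0..<p}" "i' \<in> {0..<p}" for i j i'
    using leaf_hub[OF that] by blast
  show ?thesis
    unfolding iff
    using assms rot_p leaf_hub leaf_hub' leaf_leaf
    by (cases x; cases y) (simp_all add: mem, blast+)
qed

lemma metric_dimension_intersection_graph:
  "metric_dimension (intersection_graph G) = nat p * (nat p - 1) + 1"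
proof -
  have "metric_dimension (intersection_graph G) = metric_dimension (hub_graph {0..<p} {0..<p})"
  proof (rule metric_dimension_eq_if_iso[OF wf_hub_graph])
    show "pair_wf_digraph (intersection_graph G)"
      by standard (auto simp: intersection_graph_def)
    show "bij_betw subgroup_of (pverts (hub_graph {0..<p} {0..<p})) (pverts (intersection_graph G))"
      using bij_subgroup_of by (simp add: intersection_graph_def)
    fix x y assume "x \<in> pverts (hub_graph {0..<p} {0..<p})" "y \<in> pverts (hub_graph {0..<p} {0..<p})"
    then have xy: "x \<in> V" "y \<in> V" by simp_all
    then have "subgroup_of x \<in> proper_nontrivial_subgroups G"
        "subgroup_of y \<in> proper_nontrivial_subgroups G" "subgroup_of x = subgroup_of y \<longleftrightarrow> x = y"
      using bij_subgroup_of by (auto simp: bij_betw_def inj_on_eq_iff)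
    with xy Int_nontrivial_iff_meets[OF xy]
    show "(subgroup_of x, subgroup_of y) \<in> parcs (intersection_graph G) \<longleftrightarrow>
        (x, y) \<in> parcs (hub_graph {0..<p} {0..<p})"
      by (simp add: intersection_graph_def hub_graph_arc_iff)
  qed
  also have "\<dots> = nat p * (nat p - 1) + 1"
    using p_bounds by (subst metric_dimension_hub_graph) auto
  finally show ?thesis .
qed

end

theorem theorem4p3:
  fixes p :: nat
  assumes "prime p"
  shows "metric_dimension (intersection_graph (dihedral_group (p^2))) = p^2 - p + 1"
proof -
  have "p\<^sup>2 > 0" using assms by (simp add: prime_gt_0_nat)
  then obtain rot refl where "dihedral (dihedral_group (p\<^sup>2)) (int (p\<^sup>2)) rot refl"
    using dihedral_dihedral_group by blast
  then interpret dihedral_prime_square "dihedral_group (p\<^sup>2)" "int p" rot refl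
    using assms by (simp add: dihedral_prime_square_def dihedral_prime_square_axioms_def)
  show ?thesis
    using metric_dimension_intersection_graph by (simp add: power2_eq_square diff_mult_distrib2)
qed

end
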